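(* Let $f:\mathbb{R}^n\to\mathbb{R}$ be an $L$-smooth function satisfying $\arg\min f\neq\emptyset$. Let $x_k\in\mathbb{R}^n$ and $h>0$, and assume that $\nabla f(x_k)\neq0$ and $h\le 2/L$ hold. If $\eta_k>0$ satisfies $F_h(\eta_k;x_k)=0$, then $$\left(1+\frac{Lh}{2}\right)^{-1}\leq\eta_k\leq\left(1-\frac{Lh}{2}\right)^{-1},$$ where the right-hand side is read as $+\infty$ when $h=2/L$.
   Context: A function $f$ is $L$-smooth ($L>0$) if it is differentiable and $\nabla f$ is Lipschitz continuous with constant $L$. For $h>0$, $\eta\in\mathbb{R}$ and $x\in\mathbb{R}^n$, define $$F_h(\eta;x)=f(x-\eta h\nabla f(x))-f(x)+h\eta^2\|\nabla f(x)\|^2,$$ where $\|\cdot\|$ is the Euclidean norm. *)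

theory Defs
  imports "HOL-Analysis.Analysis"
begin

text \<open>The gradient is the vector representing the Frechet derivative; it is only meaningful at
  points where \<open>f\<close> is differentiable.\<close>

definition gradient :: "(real ^ 'n \<Rightarrow> real) \<Rightarrow> real ^ 'n \<Rightarrow> real ^ 'n" where
  "gradient f x = (THE D. GDERIV f x :> D)"

lemma gradient_eqI:
  fixes f :: "real ^ 'n \<Rightarrow> real"
  assumes "GDERIV f x :> D"
  shows "gradient f x = D"
  unfolding gradient_def
proof (rule the_equality)
  show "GDERIV f x :> D" by (rule assms)
next
  fix D' assume "GDERIV f x :> D'"
  with assms have "(\<lambda>v. inner v D') = (\<lambda>v. inner v D)"
    unfolding gderiv_def by (blast intro: has_derivative_unique)
  then have "\<forall>v. inner v D' = inner v D" by (simp add: fun_eq_iff)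
  then show "D' = D" by (simp only: vector_eq_ldot)
qed

lemma GDERIV_gradient:
  fixes f :: "real ^ 'n \<Rightarrow> real"
  assumes "f differentiable (at x)"
  shows "GDERIV f x :> gradient f x"
proof -
  from assms obtain f' where f': "(f has_derivative f') (at x)"
    by (auto simp: differentiable_def)
  then have lin: "linear f'" by (rule has_derivative_linear)
  have "f' = (\<lambda>v. inner v (adjoint f' 1))"
    using adjoint_works[OF lin, of _ 1] by (intro ext) simp
  with f' have "GDERIV f x :> adjoint f' 1"
    by (simp add: gderiv_def)
  then show ?thesis by (simp add: gradient_eqI)
qed

definition L_smooth :: "real \<Rightarrow> (real ^ 'n \<Rightarrow> real) \<Rightarrow> bool" where
  "L_smooth L f \<longleftrightarrow>
     L > 0 \<and> (\<forall>x. f differentiable (at x)) \<and> L-lipschitz_on UNIV (gradient f)"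

definition argmin_set :: "('a \<Rightarrow> real) \<Rightarrow> 'a set" where
  "argmin_set f = {x. is_arg_min f (\<lambda>_. True) x}"

definition F :: "(real ^ 'n \<Rightarrow> real) \<Rightarrow> real \<Rightarrow> real \<Rightarrow> real ^ 'n \<Rightarrow> real" where
  "F f h \<eta> x =
     f (x - (\<eta> * h) *\<^sub>R gradient f x) - f x + h * \<eta>\<^sup>2 * (norm (gradient f x))\<^sup>2"

end

theory Submission
  imports Defs
begin

text \<open>An \<open>L\<close>-Lipschitz gradient keeps \<open>f\<close> within
  \<open>L / 2 * (norm d)\<^sup>2\<close> of its linearization, on both sides. Take \<open>d\<close>
  to be the step \<open>- \<eta>k * h * g\<close>, where \<open>g\<close> is the gradient at
  \<open>xk\<close>. The equation \<open>F = 0\<close> fixes the change of \<open>f\<close> over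
  this step, and comparing it with the two quadratic bounds gives, after division by a positive
  common factor, one linear inequality in \<open>\<eta>k\<close> for each side of the claim.\<close>

lemma lipschitz_gradient_upper_bound:
  fixes f :: "'a::real_inner \<Rightarrow> real"
  assumes grad: "\<And>z. GDERIV f z :> G z"
    and lip: "L-lipschitz_on UNIV G"
  shows "f (x + d) \<le> f x + d \<bullet> G x + L / 2 * (norm d)\<^sup>2"
proof -
  \<comment> \<open>\<open>\<phi>\<close> is \<open>f\<close> along the ray minus the linear and
    quadratic terms of the bound, so the claim is exactly \<open>\<phi> 1 \<le> \<phi> 0\<close>.
    Monotonicity replaces integrating the gradient along the segment.\<close>
  define \<phi> where "\<phi> t = f (x + t *\<^sub>R d) - t * (d \<bullet> G x) - L / 2 * t\<^sup>2 * (norm d)\<^sup>2" for t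
  have "\<exists>y. DERIV \<phi> t :> y \<and> y \<le> 0" if "0 \<le> t" for t
  proof (intro exI conjI)
    have "((\<lambda>t. f (x + t *\<^sub>R d)) has_derivative (\<lambda>s. (s *\<^sub>R d) \<bullet> G (x + t *\<^sub>R d))) (at t)"
      by (rule has_derivative_compose[OF _ grad[unfolded gderiv_def]])
        (auto intro!: derivative_eq_intros)
    then have line: "((\<lambda>t. f (x + t *\<^sub>R d)) has_real_derivative d \<bullet> G (x + t *\<^sub>R d)) (at t)"
      by (rule has_derivative_imp_has_field_derivative) simp
    show "DERIV \<phi> t :> d \<bullet> G (x + t *\<^sub>R d) - d \<bullet> G x - L * t * (norm d)\<^sup>2"
      unfolding \<phi>_def by (rule derivative_eq_intros line refl | simp)+
    \<comment> \<open>Cauchy-Schwarz and the Lipschitz condition bound the gradient's variation by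
      the derivative of the quadratic term; \<open>t \<ge> 0\<close> turns
      \<open>norm (t *\<^sub>R d)\<close> into \<open>t * norm d\<close>.\<close>
    have "d \<bullet> G (x + t *\<^sub>R d) - d \<bullet> G x \<le> norm d * norm (G (x + t *\<^sub>R d) - G x)"
      using norm_cauchy_schwarz[of d "G (x + t *\<^sub>R d) - G x"] by (simp add: inner_diff_right)
    also have "\<dots> \<le> norm d * (L * norm (t *\<^sub>R d))"
      using lipschitz_onD[OF lip, of "x + t *\<^sub>R d" x] by (intro mult_left_mono) (simp_all add: dist_norm)
    finally show "d \<bullet> G (x + t *\<^sub>R d) - d \<bullet> G x - L * t * (norm d)\<^sup>2 \<le> 0"
      using that by (simp add: power2_eq_square mult_ac)
  qed
  then have "\<phi> 1 \<le> \<phi> 0"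
    by (rule DERIV_nonpos_imp_nonincreasing[OF zero_le_one])
  then show ?thesis
    by (simp add: \<phi>_def)
qed

text \<open>Negation preserves the Lipschitz constant of the gradient, so this is the upper bound
  applied to \<open>- f\<close>.\<close>

lemma lipschitz_gradient_lower_bound:
  fixes f :: "'a::real_inner \<Rightarrow> real"
  assumes grad: "\<And>z. GDERIV f z :> G z"
    and lip: "L-lipschitz_on UNIV G"
  shows "f x + d \<bullet> G x - L / 2 * (norm d)\<^sup>2 \<le> f (x + d)"
proof -
  have "GDERIV (\<lambda>z. - f z) z :> - G z" for z
    by (rule GDERIV_minus[OF grad])
  moreover have "L-lipschitz_on UNIV (\<lambda>z. - G z)"
    using lip by simp
  ultimately show ?thesis
    using lipschitz_gradient_upper_bound[of "\<lambda>z. - f z" "\<lambda>z. - G z" L x d] by simp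
qed

theorem theorem3p6:
  fixes f :: "real ^ 'n \<Rightarrow> real" and L h \<eta>k :: real and xk :: "real ^ 'n"
  assumes "L_smooth L f"
    and "argmin_set f \<noteq> {}"
    and "h > 0"
    and "gradient f xk \<noteq> 0"
    and "h \<le> 2 / L"
    and "\<eta>k > 0"
    and "F f h \<eta>k xk = 0"
  shows "inverse (1 + L * h / 2) \<le> \<eta>k \<and>
         ereal \<eta>k \<le> (if h = 2 / L then \<infinity> else ereal (inverse (1 - L * h / 2)))"
proof -
  define g where "g = gradient f xk"
  define d where "d = - ((\<eta>k * h) *\<^sub>R g)"
  have L: "L > 0" and lip: "L-lipschitz_on UNIV (gradient f)"
    and grad: "\<And>z. GDERIV f z :> gradient f z"
    using assms(1) by (auto simp: L_smooth_def intro: GDERIV_gradient)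
  \<comment> \<open>The change of \<open>f\<close>, the linear term and the quadratic term are all
    multiples of \<open>c\<close>; the nonzero gradient makes \<open>c\<close> positive, hence
    cancellable.\<close>
  define c where "c = h * \<eta>k * (norm g)\<^sup>2"
  have c: "c > 0"
    using assms(3,4,6) by (simp add: c_def g_def)
  have diff: "f (xk + d) - f xk = - (c * \<eta>k)"
    using assms(7) by (simp add: F_def c_def d_def g_def power2_eq_square algebra_simps)
  have lin: "d \<bullet> g = - c"
    by (simp add: d_def c_def power2_norm_eq_inner)
  have quad: "L / 2 * (norm d)\<^sup>2 = c * (L * h / 2 * \<eta>k)"
    by (simp add: d_def c_def power_mult_distrib power2_eq_square)
  \<comment> \<open>The upper bound on \<open>f\<close> limits the decrease from below, which forces
    \<open>\<eta>k\<close> to be large enough; the lower bound on \<open>f\<close> will cap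
    it.\<close>
  have "c * 1 \<le> c * ((1 + L * h / 2) * \<eta>k)"
    using lipschitz_gradient_upper_bound[OF grad lip, of xk d, folded g_def, unfolded lin quad] diff
    by (simp add: algebra_simps)
  then have lower: "1 \<le> (1 + L * h / 2) * \<eta>k"
    using c by (simp only: mult_le_cancel_left_pos)
  have "c * ((1 - L * h / 2) * \<eta>k) \<le> c * 1"
    using lipschitz_gradient_lower_bound[OF grad lip, of xk d, folded g_def, unfolded lin quad] diff
    by (simp add: algebra_simps)
  then have upper: "(1 - L * h / 2) * \<eta>k \<le> 1"
    using c by (simp only: mult_le_cancel_left_pos)
  have "1 + L * h / 2 > 0"
    using L assms(3) by (simp add: add_pos_pos)
  then have "inverse (1 + L * h / 2) \<le> \<eta>k"
    using lower by (simp add: inverse_eq_divide pos_divide_le_eq mult.commute)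
  \<comment> \<open>Away from \<open>h = 2 / L\<close> the factor \<open>1 - L * h / 2\<close> is
    strictly positive, so division is legitimate; at equality the stated bound is infinite.\<close>
  moreover have "\<eta>k \<le> inverse (1 - L * h / 2)" if "h \<noteq> 2 / L"
  proof -
    have "1 - L * h / 2 > 0"
      using L assms(5) that by (simp add: field_simps)
    then show ?thesis
      using upper by (simp add: inverse_eq_divide pos_le_divide_eq mult.commute)
  qed
  ultimately show ?thesis
    by simp
qed

end
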